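(* Let $\theta(n)$ be an integer-valued function of $n$ with $1\leq\theta(n)\leq n$. Then for every undirected simple graph $G$ on $n$ vertices, the number of even induced subgraphs of $G$ whose order lies in the interval $[\theta(n)/2,\theta(n)]$ is at least $$\binom{n}{n-\theta(n)}\Big/\binom{n-\frac{1}{2}\theta(n)}{n-\theta(n)}.$$
   Context: An induced subgraph is even if every vertex has even degree in it; induced subgraphs are counted as vertex subsets. The binomial coefficient $\binom{x}{m}$ with possibly non-integer $x$ denotes $x(x-1)\cdots(x-m+1)/m!$. *)

theory Defs
  imports Complex_Main "Graph_Theory.Digraph_Component"
begin

text \<open>
  An undirected simple graph is a finite, loop-free, symmetric digraph without parallel arcs
  (locale \<^locale>\<open>graph\<close>): an edge between two vertices is represented by the two arcs joining
  them, so the degree of a vertex is its out-degree.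
\<close>

definition even_graph :: "('a, 'b) pre_digraph \<Rightarrow> bool" where
  "even_graph G \<longleftrightarrow> (\<forall>v \<in> verts G. even (out_degree G v))"

end

theory Submission
  imports Defs
begin

text \<open>
  By Gallai's theorem every graph has a vertex partition into two parts inducing even subgraphs,
  so every \<open>\<theta>\<close>-subset of the vertices contains an even induced subgraph of order at least
  \<open>\<theta>/2\<close>. Conversely, a set of order \<open>s \<ge> \<theta>/2\<close> lies in only
  \<open>(n - s) choose (n - \<theta>) \<le> (n - \<theta>/2) choose (n - \<theta>)\<close> of the \<open>\<theta>\<close>-subsets.
\<close>

text \<open>Stated for a bare relation on a vertex set: the induction behind Gallai's theorem alters
  the edges while the vertices stay put, so no new digraph has to be built.\<close>

definition even_in :: "('a \<Rightarrow> 'a \<Rightarrow> bool) \<Rightarrow> 'a set \<Rightarrow> bool" where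
  "even_in E A \<longleftrightarrow> (\<forall>v\<in>A. even (card {u\<in>A. E v u}))"

text \<open>With \<open>N\<close> the neighbourhood of a vertex this is local complementation there.
  Excluding \<open>u = w\<close> keeps the relation loop-free.\<close>

definition toggle_in :: "'a set \<Rightarrow> ('a \<Rightarrow> 'a \<Rightarrow> bool) \<Rightarrow> 'a \<Rightarrow> 'a \<Rightarrow> bool" where
  "toggle_in N E u w \<longleftrightarrow> (if u \<in> N \<and> w \<in> N \<and> u \<noteq> w then \<not> E u w else E u w)"

lemma card_toggle_in_outside:
  assumes "u \<notin> N"
  shows "card {w\<in>A. toggle_in N E u w} = card {w\<in>A. E u w}"
  using assms by (simp add: toggle_in_def)

text \<open>Toggling exchanges the neighbours and non-neighbours of \<open>u\<close> among the other
  \<open>card (A \<inter> N) - 1\<close> vertices of \<open>A \<inter> N\<close>, so the degree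
  parity flips exactly when \<open>card (A \<inter> N)\<close> is even.\<close>

lemma even_card_toggle_in:
  assumes "finite A" "u \<in> A \<inter> N" "\<not> E u u"
  shows "even (card {w\<in>A. toggle_in N E u w})
         \<longleftrightarrow> (even (card {w\<in>A. E u w}) \<longleftrightarrow> odd (card (A \<inter> N)))"
proof -
  let ?P = "{w\<in>A - N. E u w}" and ?Q = "{w\<in>A \<inter> N. E u w}"
  let ?R = "{w\<in>A \<inter> N. w \<noteq> u \<and> \<not> E u w}"
  have "{w\<in>A. toggle_in N E u w} = ?P \<union> ?R"
    using assms by (auto simp: toggle_in_def)
  then have 1: "card {w\<in>A. toggle_in N E u w} = card ?P + card ?R"
    using assms(1) by (simp add: card_Un_disjoint disjoint_iff)
  have "{w\<in>A. E u w} = ?P \<union> ?Q" by auto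
  then have 2: "card {w\<in>A. E u w} = card ?P + card ?Q"
    using assms(1) by (simp add: card_Un_disjoint disjoint_iff)
  \<comment> \<open>Having no loop, \<open>u\<close> lies in neither \<open>?Q\<close> nor
    \<open>?R\<close>; it accounts for the \<open>Suc\<close> that shifts the parity.\<close>
  have "A \<inter> N = insert u (?Q \<union> ?R)" using assms by auto
  moreover have "card (insert u (?Q \<union> ?R)) = Suc (card (?Q \<union> ?R))"
    using assms by (intro card_insert_disjoint) auto
  moreover have "card (?Q \<union> ?R) = card ?Q + card ?R"
    using assms(1) by (intro card_Un_disjoint) auto
  ultimately have 3: "card (A \<inter> N) = Suc (card ?Q + card ?R)" by metis
  show ?thesis unfolding 1 2 3 by auto
qed

text \<open>As \<open>v\<close> has evenly many neighbours in \<open>A\<close>, undoing the toggle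
  flips the degree parity of each of them, and the new edge to \<open>v\<close> flips it back. Other
  vertices of \<open>A\<close> see neither change.\<close>

lemma even_in_insert_toggle:
  assumes fin: "finite A" and sym: "symp E" and irr: "irreflp E" and v: "v \<notin> A"
    and evn: "even (card {w\<in>A. E v w})" and A: "even_in (toggle_in {w\<in>W. E v w} E) A"
    and AW: "A \<subseteq> W"
  shows "even_in E (insert v A)"
  unfolding even_in_def
proof
  fix u assume u: "u \<in> insert v A"
  let ?N = "{w\<in>W. E v w}"
  have AN: "A \<inter> ?N = {w\<in>A. E v w}" using AW by auto
  show "even (card {w\<in>insert v A. E u w})"
  proof (cases "u = v")
    case True
    then have "{w\<in>insert v A. E u w} = {w\<in>A. E v w}"
      using irr by (auto dest: irreflpD)
    with evn show ?thesis by simp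
  next
    case False
    with u have uA: "u \<in> A" by simp
    have ev: "even (card {w\<in>A. toggle_in ?N E u w})" using A uA by (simp add: even_in_def)
    show ?thesis
    proof (cases "E u v")
      case True
      then have "u \<in> A \<inter> ?N" using sym uA AW by (auto dest: sympD)
      then have "odd (card {w\<in>A. E u w})"
        using ev even_card_toggle_in[OF fin, of u ?N E] irr evn by (auto simp: AN dest: irreflpD)
      moreover have "{w\<in>insert v A. E u w} = insert v {w\<in>A. E u w}" using True by auto
      ultimately show ?thesis using fin v by simp
    next
      case False
      then have "u \<notin> ?N" using sym by (auto dest: sympD)
      then have "even (card {w\<in>A. E u w})" using ev by (simp add: card_toggle_in_outside)
      moreover have "{w\<in>insert v A. E u w} = {w\<in>A. E u w}" using False by auto
      ultimately show ?thesis by simp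
    qed
  qed
qed

text \<open>With an odd number of neighbours of \<open>v\<close> in \<open>B\<close>, each of them
  has an even number of others to toggle against, so no degree parity changes.\<close>

lemma even_in_of_toggle:
  assumes fin: "finite B" and irr: "irreflp E" and BW: "B \<subseteq> W"
    and odd: "odd (card {w\<in>B. E v w})" and B: "even_in (toggle_in {w\<in>W. E v w} E) B"
  shows "even_in E B"
  unfolding even_in_def
proof
  fix u assume u: "u \<in> B"
  let ?N = "{w\<in>W. E v w}"
  have BN: "B \<inter> ?N = {w\<in>B. E v w}" using BW by auto
  have ev: "even (card {w\<in>B. toggle_in ?N E u w})" using B u by (simp add: even_in_def)
  show "even (card {w\<in>B. E u w})"
  proof (cases "u \<in> ?N")
    case True
    with u ev odd show ?thesis
      using even_card_toggle_in[OF fin, of u ?N E] irr by (auto simp: BN dest: irreflpD)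
  next
    case False
    with ev show ?thesis by (simp add: card_toggle_in_outside)
  qed
qed

text \<open>
  Gallai's theorem, by induction: delete a vertex \<open>v\<close> of odd degree and complement the graph
  induced on its neighbourhood. Exactly one part of the partition obtained for the smaller graph
  contains an even number of neighbours of \<open>v\<close>, and \<open>v\<close> is put there.
\<close>

theorem gallai_even_partition:
  assumes "finite W" "symp E" "irreflp E"
  shows "\<exists>A B. A \<union> B = W \<and> A \<inter> B = {} \<and> even_in E A \<and> even_in E B"
  using assms
proof (induction "card W" arbitrary: W E rule: less_induct)
  case less
  show ?case
  proof (cases "even_in E W")
    case True
    then have "W \<union> {} = W \<and> W \<inter> {} = {} \<and> even_in E W \<and> even_in E {}"
      by (simp add: even_in_def)
    then show ?thesis by blast
  next
    case False
    then obtain v where v: "v \<in> W" "odd (card {u\<in>W. E v u})" by (auto simp: even_in_def)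
    let ?N = "{u\<in>W. E v u}"
    have "symp (toggle_in ?N E)" "irreflp (toggle_in ?N E)"
      using less.prems(2,3) by (auto simp: toggle_in_def symp_def irreflp_def)
    moreover have "card (W - {v}) < card W" using v(1) less.prems(1) by (rule card_Diff1_less[rotated])
    ultimately obtain A B where AB: "A \<union> B = W - {v}" "A \<inter> B = {}"
      "even_in (toggle_in ?N E) A" "even_in (toggle_in ?N E) B"
      using less.hyps[of "W - {v}" "toggle_in ?N E"] less.prems(1) by auto
    have fin: "finite A" "finite B" using AB(1) less.prems(1)
      by (metis finite_Diff finite_Un)+
    have "?N = {u\<in>A. E v u} \<union> {u\<in>B. E v u}"
      using AB(1) less.prems(3) by (auto dest: irreflpD)
    moreover have "card ({u\<in>A. E v u} \<union> {u\<in>B. E v u}) = card {u\<in>A. E v u} + card {u\<in>B. E v u}"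
      using fin AB(2) by (intro card_Un_disjoint) auto
    ultimately have par: "odd (card {u\<in>A. E v u} + card {u\<in>B. E v u})" using v(2) by simp
    \<comment> \<open>Kept generic in \<open>A'\<close> and \<open>B'\<close>, since either part of
      the partition may be the one that receives \<open>v\<close>.\<close>
    have extend: ?thesis
      if "A' \<union> B' = W - {v}" "A' \<inter> B' = {}" "even_in (toggle_in ?N E) A'"
        "even_in (toggle_in ?N E) B'" "finite A'" "finite B'"
        "even (card {u\<in>A'. E v u})" "odd (card {u\<in>B'. E v u})" for A' B'
    proof -
      have "even_in E (insert v A')"
        by (rule even_in_insert_toggle[where W = W]) (use that less.prems in auto)
      moreover have "even_in E B'"
        by (rule even_in_of_toggle[where W = W and v = v]) (use that less.prems in auto)
      moreover have "insert v A' \<union> B' = W" "insert v A' \<inter> B' = {}" using that v by auto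
      ultimately show ?thesis by blast
    qed
    show ?thesis
    proof (cases "even (card {u\<in>A. E v u})")
      case True
      with par AB fin show ?thesis by (intro extend[of A B]) auto
    next
      case False
      with par AB fin show ?thesis by (intro extend[of B A]) auto
    qed
  qed
qed

text \<open>Without parallel arcs, \<open>head G\<close> maps the arcs leaving a vertex bijectively
  onto its neighbours, so out-degrees count neighbours.\<close>

lemma (in graph) even_graph_induce_iff:
  assumes "S \<subseteq> verts G"
  shows "even_graph (G \<restriction> S) \<longleftrightarrow> even_in (\<lambda>u w. u \<rightarrow>\<^bsub>G\<^esub> w) S"
proof -
  have "out_degree (G \<restriction> S) v = card {u\<in>S. v \<rightarrow>\<^bsub>G\<^esub> u}" if "v \<in> S" for v
  proof -
    have "bij_betw (head G) (out_arcs (G \<restriction> S) v) {u\<in>S. v \<rightarrow>\<^bsub>G\<^esub> u}"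
      using that no_multi_arcs
      by (force simp: bij_betw_def inj_on_def out_arcs_def arcs_ends_def arc_to_ends_def)
    then show ?thesis by (simp add: out_degree_def bij_betw_same_card)
  qed
  then show ?thesis by (simp add: even_graph_def even_in_def)
qed

text \<open>A superset \<open>T\<close> of \<open>S\<close> is determined by \<open>T - S\<close>, a
  subset of \<open>V - S\<close> of size \<open>t - card S\<close>.\<close>

lemma card_supersets_of_card_le:
  assumes "finite V" "S \<subseteq> V" "card S \<le> t"
  shows "card {T. S \<subseteq> T \<and> T \<subseteq> V \<and> card T = t} \<le> (card V - card S) choose (t - card S)"
proof -
  let ?U = "{U. U \<subseteq> V - S \<and> card U = t - card S}"
  have finS: "finite S" using assms finite_subset by blast
  have "{T. S \<subseteq> T \<and> T \<subseteq> V \<and> card T = t} \<subseteq> (\<lambda>U. S \<union> U) ` ?U"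
  proof
    fix T assume T: "T \<in> {T. S \<subseteq> T \<and> T \<subseteq> V \<and> card T = t}"
    then have "T - S \<in> ?U" using finS by (auto simp: card_Diff_subset)
    moreover have "T = S \<union> (T - S)" using T by auto
    ultimately show "T \<in> (\<lambda>U. S \<union> U) ` ?U" by blast
  qed
  moreover have "finite ?U" using assms(1) by simp
  ultimately have "card {T. S \<subseteq> T \<and> T \<subseteq> V \<and> card T = t} \<le> card ?U"
    by (rule surj_card_le[rotated])
  also have "\<dots> = (card V - card S) choose (t - card S)"
    using assms finS by (simp add: n_subsets card_Diff_subset)
  finally show ?thesis .
qed

theorem theorem3p1:
  fixes \<theta> :: "nat \<Rightarrow> nat" and n :: nat and G :: "('a, 'b) pre_digraph"
  assumes theta: "\<And>m. m \<ge> 1 \<Longrightarrow> 1 \<le> \<theta> m \<and> \<theta> m \<le> m"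
    and "n \<ge> 1"
    and "graph G"
    and "card (verts G) = n"
  shows "real (card {S. S \<subseteq> verts G \<and> even_graph (G \<restriction> S) \<and>
                       real (\<theta> n) / 2 \<le> real (card S) \<and> card S \<le> \<theta> n})
         \<ge> (real n gchoose (n - \<theta> n)) / ((real n - real (\<theta> n) / 2) gchoose (n - \<theta> n))"
proof -
  interpret graph G by fact
  let ?V = "verts G" and ?t = "\<theta> n" and ?E = "\<lambda>u w. u \<rightarrow>\<^bsub>G\<^esub> w"
  let ?F = "{S. S \<subseteq> ?V \<and> even_graph (G \<restriction> S) \<and> real ?t / 2 \<le> real (card S) \<and> card S \<le> ?t}"
  let ?sup = "\<lambda>S. {T. S \<subseteq> T \<and> T \<subseteq> ?V \<and> card T = ?t}"
  let ?c = "(real n - real ?t / 2) gchoose (n - ?t)"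
  have tn: "?t \<le> n" using theta \<open>n \<ge> 1\<close> by simp
  have finF: "finite ?F" by (rule finite_subset[of _ "Pow ?V"]) auto
  have "symp ?E" using sym_arcs by (auto simp: symmetric_def symp_def sym_def)
  moreover have "irreflp ?E" by (auto simp: irreflp_def dest: adj_not_same)
  ultimately have gallai: "\<exists>A B. A \<union> B = T \<and> A \<inter> B = {} \<and> even_in ?E A \<and> even_in ?E B"
    if "finite T" for T
    using gallai_even_partition[OF that] by blast
  have cover: "{T. T \<subseteq> ?V \<and> card T = ?t} \<subseteq> (\<Union>S\<in>?F. ?sup S)"
  proof
    fix T assume "T \<in> {T. T \<subseteq> ?V \<and> card T = ?t}"
    then have T: "T \<subseteq> ?V" "card T = ?t" "finite T" by (auto intro: finite_subset)
    obtain A B where AB: "A \<union> B = T" "A \<inter> B = {}" "even_in ?E A" "even_in ?E B"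
      using gallai[OF T(3)] by blast
    have fin: "finite A" "finite B" using AB(1) T(3) by auto
    have sum: "card A + card B = ?t" using card_Un_disjoint[OF fin AB(2)] AB(1) T(2) by simp
    have "even_graph (G \<restriction> A)" "even_graph (G \<restriction> B)"
      using AB T(1) by (subst even_graph_induce_iff; auto)+
    \<comment> \<open>The larger of the two parts has at least half of the \<open>?t\<close>
      vertices.\<close>
    then have "A \<in> ?F \<or> B \<in> ?F" using sum AB(1) T(1) by auto
    then show "T \<in> (\<Union>S\<in>?F. ?sup S)" using T AB(1) by blast
  qed
  have bound: "real (card (?sup S)) \<le> ?c" if "S \<in> ?F" for S
  proof -
    have S: "S \<subseteq> ?V" "real ?t / 2 \<le> real (card S)" "card S \<le> ?t" using that by auto
    have "card (?sup S) \<le> (n - card S) choose (?t - card S)"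
      using card_supersets_of_card_le[of ?V S ?t] S assms(4) by simp
    \<comment> \<open>By symmetry the lower index no longer depends on \<open>S\<close>, so
      monotonicity in the upper argument gives a bound uniform in \<open>S\<close>.\<close>
    also have "\<dots> = (n - card S) choose (n - ?t)"
      using S tn binomial_symmetric[of "?t - card S" "n - card S"] by simp
    finally have "real (card (?sup S)) \<le> real (n - card S) gchoose (n - ?t)"
      by (metis binomial_gbinomial of_nat_le_iff)
    also have "\<dots> \<le> ?c"
      using S tn by (intro gbinomial_mono) (auto simp: of_nat_diff)
    finally show ?thesis .
  qed
  have "real n gchoose (n - ?t) = real (n choose ?t)"
    using tn binomial_symmetric[of ?t n] by (simp add: binomial_gbinomial)
  also have "n choose ?t = card {T. T \<subseteq> ?V \<and> card T = ?t}"
    using assms(4) by (simp add: n_subsets)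
  also have "real (card {T. T \<subseteq> ?V \<and> card T = ?t}) \<le> real (\<Sum>S\<in>?F. card (?sup S))"
  proof -
    have "card {T. T \<subseteq> ?V \<and> card T = ?t} \<le> card (\<Union>S\<in>?F. ?sup S)"
      using finF by (intro card_mono[OF _ cover]) auto
    also have "\<dots> \<le> (\<Sum>S\<in>?F. card (?sup S))" by (rule card_UN_le[OF finF])
    finally show ?thesis by (rule of_nat_mono)
  qed
  also have "\<dots> \<le> real (card ?F) * ?c"
    using sum_bounded_above[of ?F "\<lambda>S. real (card (?sup S))" ?c] bound by simp
  finally have main: "real n gchoose (n - ?t) \<le> real (card ?F) * ?c" .
  \<comment> \<open>The left side is 1, so the denominator \<open>?c\<close> is positive and
    dividing by it preserves the inequality.\<close>
  have "real (n - ?t) gchoose (n - ?t) \<le> ?c"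
    using tn by (intro gbinomial_mono) (auto simp: of_nat_diff)
  then have "?c > 0" by (simp flip: binomial_gbinomial)
  with main show ?thesis by (simp add: pos_divide_le_eq)
qed

end
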